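(* Let $f\in\mathrm{Homeo}_+(\mathcal S)$ with lift $F(x,k)=(x+\delta_k(x),k)$ to $\mathbb R\times\widehat{\mathbb Z}$. Then for every $k\in\widehat{\mathbb Z}$ the displacement function $\delta_k:\mathbb R\to\mathbb R$ is periodic or purely limit periodic.
   Context: Universal one-dimensional solenoid: $\mathcal S=\varprojlim_n \mathbb R/n\mathbb Z$ (index set $\mathbb Z_+$ ordered by divisibility, bonding maps the canonical projections $p_{nm}:\mathbb R/m\mathbb Z\to\mathbb R/n\mathbb Z$ for $n\mid m$), a compact connected abelian topological group. Let $\widehat{\mathbb Z}=\varprojlim_n\mathbb Z/n\mathbb Z$ be the profinite completion of $\mathbb Z$, with $\mathbb Z\subset\widehat{\mathbb Z}$ densely. Equivalently $\mathcal S$ is the orbit space of $\mathbb R\times\widehat{\mathbb Z}$ under the $\mathbb Z$-action $t\cdot(x,k)=(x+t,k-t)$; let $p:\mathbb R\times\widehat{\mathbb Z}\to\mathcal S$ be the projection. $\mathrm{Homeo}_+(\mathcal S)$ is the group of orientation-preserving (along leaves) homeomorphisms of $\mathcal S$ isotopic to the identity. Each $f\in\mathrm{Homeo}_+(\mathcal S)$ has a lift $F:\mathbb R\times\widehat{\mathbb Z}\to\mathbb R\times\widehat{\mathbb Z}$ ($p\circ F=f\circ p$) of the form $F(x,k)=(F_k(x),k)$, where each $F_k:\mathbb R\to\mathbb R$ is an increasing homeomorphism, $F$ is continuous, $F_{k-t}(x+t)=F_k(x)+t$ for all $t\in\mathbb Z$, and the displacement $\delta_k=F_k-\mathrm{id}$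 is bounded and continuous. A continuous function $\mathbb R\to\mathbb R$ is periodic if it has a nonzero period (constants included); it is limit periodic if it is a uniform limit on $\mathbb R$ of continuous periodic functions, and purely limit periodic if it is limit periodic but not periodic. (For an almost periodic function, this last case is the one where the closure of the set of its translates, with its natural group structure, is a one-dimensional solenoidal group.) *)

theory Defs
  imports "HOL-Analysis.Analysis" "HOL-Library.Real_Mod"
begin

section \<open>The circles R/nZ and the universal solenoid\<close>

text \<open>A class in R/nZ is represented by its representative in [0, n); the topology is the
  quotient topology along the projection R \<rightarrow> R/nZ, not the subspace topology of [0, n).\<close>

definition circle_topology :: "nat \<Rightarrow> real topology" where
  "circle_topology n =
     topology (\<lambda>U. U \<subseteq> {0..<real n} \<and> open {x. x rmod real n \<in> U})"

lemma openin_circle_topology: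
  "openin (circle_topology n) U \<longleftrightarrow> U \<subseteq> {0..<real n} \<and> open {x. x rmod real n \<in> U}"
proof -
  have "istopology (\<lambda>U. U \<subseteq> {0..<real n} \<and> open {x. x rmod real n \<in> U})"
    unfolding istopology_def
  proof (intro conjI allI impI)
    fix S T assume "S \<subseteq> {0..<real n} \<and> open {x. x rmod real n \<in> S}"
      and "T \<subseteq> {0..<real n} \<and> open {x. x rmod real n \<in> T}"
    then have "open ({x. x rmod real n \<in> S} \<inter> {x. x rmod real n \<in> T})"
      by blast
    then show "open {x. x rmod real n \<in> S \<inter> T}"
      by (simp add: Collect_conj_eq)
  next
    fix K assume K: "\<forall>U\<in>K. U \<subseteq> {0..<real n} \<and> open {x. x rmod real n \<in> U}"
    have "{x. x rmod real n \<in> \<Union>K} = (\<Union>U\<in>K. {x. x rmod real n \<in> U})"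
      by auto
    with K show "open {x. x rmod real n \<in> \<Union>K}"
      by auto
  qed auto
  then show ?thesis
    by (simp add: circle_topology_def topology_inverse')
qed

lemma topspace_circle_topology:
  assumes "n > 0"
  shows "topspace (circle_topology n) = {0..<real n}"
proof -
  have "{x. x rmod real n \<in> {0..<real n}} = UNIV"
    using assms by (auto simp: rmod_nonneg rmod_less)
  then have "openin (circle_topology n) {0..<real n}"
    by (simp add: openin_circle_topology)
  then show ?thesis
    using openin_subset openin_circle_topology openin_topspace by blast
qed

lemma quotient_map_circle:
  assumes "n > 0"
  shows "quotient_map euclideanreal (circle_topology n) (\<lambda>x. x rmod real n)"
proof -
  have "range (\<lambda>x. x rmod real n) = {0..<real n}"
  proof (intro equalityI subsetI)
    fix y assume "y \<in> {0..<real n}"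
    then have "y = y rmod real n" by simp
    then show "y \<in> range (\<lambda>x. x rmod real n)" by blast
  qed (use assms in \<open>auto simp: rmod_nonneg rmod_less\<close>)
  then show ?thesis
    using assms
    by (simp add: quotient_map_def topspace_circle_topology openin_circle_topology)
qed

text \<open>Inverse limits are taken over the positive integers ordered by divisibility. The bonding map
  R/mZ \<rightarrow> R/nZ for n dvd m is reduction modulo n. Points are extensional functions on
  the index set, as required by \<^const>\<open>product_topology\<close>.\<close>

definition solenoid :: "(nat \<Rightarrow> real) topology" where
  "solenoid = subtopology (product_topology circle_topology {0<..})
     {s. \<forall>n m. 0 < n \<longrightarrow> 0 < m \<longrightarrow> n dvd m \<longrightarrow> s m rmod real n = s n}"

section \<open>The profinite integers\<close>

text \<open>The class of an integer in Z/nZ is represented by its residue in \<open>{0..<n}\<close>.\<close>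

definition zhat :: "(nat \<Rightarrow> int) topology" where
  "zhat = subtopology (product_topology (\<lambda>n. discrete_topology {0..<int n}) {0<..})
     {k. \<forall>n m. 0 < n \<longrightarrow> 0 < m \<longrightarrow> n dvd m \<longrightarrow> k m mod int n = k n}"

definition zhat_of_int :: "int \<Rightarrow> nat \<Rightarrow> int" where
  "zhat_of_int t = (\<lambda>n\<in>{0<..}. t mod int n)"

definition zhat_diff :: "(nat \<Rightarrow> int) \<Rightarrow> (nat \<Rightarrow> int) \<Rightarrow> nat \<Rightarrow> int" where
  "zhat_diff k l = (\<lambda>n\<in>{0<..}. (k n - l n) mod int n)"

text \<open>The projection \<open>p\<close>. Its fibres are the orbits of the action
  \<open>t \<cdot> (x, k) = (x + t, k - t)\<close> of Z, see \<open>solenoid_proj_eq_iff\<close> below.\<close>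

definition solenoid_proj :: "real \<times> (nat \<Rightarrow> int) \<Rightarrow> nat \<Rightarrow> real" where
  "solenoid_proj = (\<lambda>(x, k). \<lambda>n\<in>{0<..}. (x + of_int (k n)) rmod real n)"

section \<open>Homeomorphisms of the solenoid and their lifts\<close>

text \<open>The leaves are the images of the lines \<open>\<real> \<times> {k}\<close> and are oriented by the real coordinate.\<close>

definition leaf_orientation_preserving :: "((nat \<Rightarrow> real) \<Rightarrow> nat \<Rightarrow> real) \<Rightarrow> bool" where
  "leaf_orientation_preserving f \<longleftrightarrow>
     (\<forall>k\<in>topspace zhat. \<exists>l\<in>topspace zhat. \<exists>g::real \<Rightarrow> real.
        continuous_on UNIV g \<and> strict_mono g \<and>
        (\<forall>x. f (solenoid_proj (x, k)) = solenoid_proj (g x, l)))"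

text \<open>Being isotopic to the identity means being homotopic to it through homeomorphisms.
  Only the values of \<open>f\<close> on \<open>topspace solenoid\<close> are relevant.\<close>

definition homeo_plus :: "((nat \<Rightarrow> real) \<Rightarrow> nat \<Rightarrow> real) set" where
  "homeo_plus = {f. homeomorphic_map solenoid solenoid f \<and>
     homotopic_with (homeomorphic_map solenoid solenoid) solenoid solenoid id f \<and>
     leaf_orientation_preserving f}"

definition leaf_map :: "(real \<times> (nat \<Rightarrow> int) \<Rightarrow> real \<times> (nat \<Rightarrow> int)) \<Rightarrow> (nat \<Rightarrow> int) \<Rightarrow> real \<Rightarrow> real"
  where "leaf_map F k x = fst (F (x, k))"

definition is_lift ::
  "((nat \<Rightarrow> real) \<Rightarrow> nat \<Rightarrow> real) \<Rightarrow> (real \<times> (nat \<Rightarrow> int) \<Rightarrow> real \<times> (nat \<Rightarrow> int)) \<Rightarrow> bool" where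
  "is_lift f F \<longleftrightarrow>
     continuous_map (prod_topology euclideanreal zhat) (prod_topology euclideanreal zhat) F \<and>
     (\<forall>x. \<forall>k\<in>topspace zhat. solenoid_proj (F (x, k)) = f (solenoid_proj (x, k))) \<and>
     (\<forall>x. \<forall>k\<in>topspace zhat. snd (F (x, k)) = k) \<and>
     (\<forall>k\<in>topspace zhat. strict_mono (leaf_map F k) \<and>
        homeomorphic_map euclideanreal euclideanreal (leaf_map F k)) \<and>
     (\<forall>k\<in>topspace zhat. \<forall>t::int. \<forall>x.
        leaf_map F (zhat_diff k (zhat_of_int t)) (x + of_int t) = leaf_map F k x + of_int t) \<and>
     (\<forall>k\<in>topspace zhat. bounded (range (\<lambda>x. leaf_map F k x - x)) \<and>
        continuous_on UNIV (\<lambda>x. leaf_map F k x - x))"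

section \<open>Limit periodic functions\<close>

definition periodic_function :: "(real \<Rightarrow> real) \<Rightarrow> bool" where
  "periodic_function \<phi> \<longleftrightarrow> continuous_on UNIV \<phi> \<and> (\<exists>T. T \<noteq> 0 \<and> (\<forall>x. \<phi> (x + T) = \<phi> x))"

definition limit_periodic :: "(real \<Rightarrow> real) \<Rightarrow> bool" where
  "limit_periodic \<phi> \<longleftrightarrow>
     (\<exists>\<psi>. (\<forall>i::nat. periodic_function (\<psi> i)) \<and> uniform_limit UNIV \<psi> \<phi> sequentially)"

definition purely_limit_periodic :: "(real \<Rightarrow> real) \<Rightarrow> bool" where
  "purely_limit_periodic \<phi> \<longleftrightarrow> limit_periodic \<phi> \<and> \<not> periodic_function \<phi>"

section \<open>Basic facts about the encoding\<close>

lemma topspace_solenoid: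
  "topspace solenoid = {s \<in> (\<Pi>\<^sub>E n\<in>{0<..}. {0..<real n}).
     \<forall>n m. 0 < n \<longrightarrow> 0 < m \<longrightarrow> n dvd m \<longrightarrow> s m rmod real n = s n}"
proof -
  have "(\<Pi>\<^sub>E n\<in>{0<..}. topspace (circle_topology n)) = (\<Pi>\<^sub>E n\<in>{0<..}. {0..<real n})"
    by (rule PiE_cong) (simp add: topspace_circle_topology)
  then show ?thesis
    by (auto simp: solenoid_def)
qed

lemma topspace_zhat:
  "topspace zhat = {k \<in> (\<Pi>\<^sub>E n\<in>{0<..}. {0..<int n}).
     \<forall>n m. 0 < n \<longrightarrow> 0 < m \<longrightarrow> n dvd m \<longrightarrow> k m mod int n = k n}"
  by (auto simp: zhat_def)

lemma rmod_eq_iff: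
  assumes "n > 0"
  shows "x rmod real n = y rmod real n \<longleftrightarrow> (\<exists>j::int. x = y + of_int j * real n)"
proof
  assume "x rmod real n = y rmod real n"
  then have "x = y + of_int (\<lfloor>x / real n\<rfloor> - \<lfloor>y / real n\<rfloor>) * real n"
    by (simp add: rmod_def algebra_simps)
  then show "\<exists>j::int. x = y + of_int j * real n" by blast
next
  assume "\<exists>j::int. x = y + of_int j * real n"
  then obtain j :: int where "x = y + of_int j * real n" by blast
  then have "x = y rmod real n + of_int (\<lfloor>y / real n\<rfloor> + j) * real n"
    by (simp add: rmod_def algebra_simps)
  then show "x rmod real n = y rmod real n"
    using assms by (intro rmod_unique[where n = "\<lfloor>y / real n\<rfloor> + j"]) (auto simp: rmod_nonneg rmod_less)
qed

lemma zhat_of_int_in: "zhat_of_int t \<in> topspace zhat"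
  by (auto simp: topspace_zhat zhat_of_int_def mod_mod_cancel)

lemma zhat_diff_in:
  assumes "k \<in> topspace zhat" "l \<in> topspace zhat"
  shows "zhat_diff k l \<in> topspace zhat"
proof -
  have "(k m - l m) mod int m mod int n = (k n - l n) mod int n"
    if "0 < n" "0 < m" "n dvd m" for n m
  proof -
    have "(k m - l m) mod int m mod int n = (k m mod int n - l m mod int n) mod int n"
      using that by (simp add: mod_mod_cancel mod_diff_eq)
    then show ?thesis
      using assms that by (simp add: topspace_zhat)
  qed
  then show ?thesis
    by (auto simp: topspace_zhat zhat_diff_def)
qed

lemma solenoid_proj_in:
  assumes k: "k \<in> topspace zhat"
  shows "solenoid_proj (x, k) \<in> topspace solenoid"
proof -
  have "(x + of_int (k m)) rmod real m rmod real n = (x + of_int (k n)) rmod real n"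
    if nm: "0 < n" "0 < m" "n dvd m" for n m
  proof -
    obtain c where c: "m = n * c" using nm by blast
    have "k m mod int n = k n" using k nm by (auto simp: topspace_zhat)
    then have "k m = k n + (k m div int n) * int n"
      by (metis div_mult_mod_eq add.commute)
    then have "real_of_int (k m) = of_int (k n) + of_int (k m div int n) * real n"
      by (metis of_int_add of_int_mult of_int_of_nat_eq)
    then have "(x + of_int (k m)) rmod real m =
        (x + of_int (k n)) + of_int (k m div int n - int c * \<lfloor>(x + of_int (k m)) / real m\<rfloor>) * real n"
      by (simp add: rmod_def c algebra_simps)
    then show ?thesis
      using nm rmod_eq_iff by blast
  qed
  then show ?thesis
    by (auto simp: topspace_solenoid solenoid_proj_def rmod_nonneg rmod_less)
qed

lemma solenoid_proj_eq_iff: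
  assumes k: "k \<in> topspace zhat" and l: "l \<in> topspace zhat"
  shows "solenoid_proj (x, k) = solenoid_proj (y, l) \<longleftrightarrow>
    (\<exists>t::int. y = x + of_int t \<and> l = zhat_diff k (zhat_of_int t))"
proof
  assume eq: "solenoid_proj (x, k) = solenoid_proj (y, l)"
  have *: "\<exists>j::int. y + of_int (l n) = x + of_int (k n) + of_int j * real n" if "n > 0" for n
    using fun_cong[OF eq, of n] that rmod_eq_iff[of n "y + of_int (l n)" "x + of_int (k n)"]
    by (simp add: solenoid_proj_def)
  obtain j where "y + of_int (l 1) = x + of_int (k 1) + of_int j * real 1"
    using *[of 1] by auto
  then have y: "y = x + of_int (k 1 - l 1 + j)" by simp
  define t where "t = k 1 - l 1 + j"
  have "l n = (k n - t mod int n) mod int n" if n: "n > 0" for n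
  proof -
    obtain i :: int where "y + of_int (l n) = x + of_int (k n) + of_int i * real n"
      using *[OF n] by blast
    then have "real_of_int (l n) = of_int (k n - t + i * int n)"
      using y by (simp add: t_def)
    then have "l n = k n - t + i * int n" by linarith
    moreover have "l n mod int n = l n"
      using l n by (auto simp: topspace_zhat)
    ultimately have "l n = (k n - t) mod int n"
      by (metis mod_mult_self1)
    then show ?thesis by (simp add: mod_diff_right_eq)
  qed
  then have "l = zhat_diff k (zhat_of_int t)"
    using l by (intro extensionalityI[of _ "{0<..}"])
      (auto simp: topspace_zhat zhat_diff_def zhat_of_int_def PiE_def)
  with y show "\<exists>t::int. y = x + of_int t \<and> l = zhat_diff k (zhat_of_int t)"
    unfolding t_def by blast
next
  assume "\<exists>t::int. y = x + of_int t \<and> l = zhat_diff k (zhat_of_int t)"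
  then obtain t :: int where t: "y = x + of_int t" "l = zhat_diff k (zhat_of_int t)" by blast
  have "(x + of_int (k n)) rmod real n = (y + of_int (l n)) rmod real n" if n: "n > 0" for n
  proof -
    have "l n = (k n - t) mod int n"
      using n t by (simp add: zhat_diff_def zhat_of_int_def mod_diff_right_eq)
    then have "k n - t = l n + ((k n - t) div int n) * int n"
      by simp
    then have "real_of_int (k n - t) = of_int (l n + ((k n - t) div int n) * int n)"
      by presburger
    then have "x + of_int (k n) = y + of_int (l n) + of_int ((k n - t) div int n) * real n"
      using t by simp
    then show ?thesis using n rmod_eq_iff by blast
  qed
  then show "solenoid_proj (x, k) = solenoid_proj (y, l)"
    by (auto simp: solenoid_proj_def restrict_def)
qed

lemma solenoid_proj_surj:
  assumes s: "s \<in> topspace solenoid"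
  shows "\<exists>k\<in>topspace zhat. solenoid_proj (s 1, k) = s"
proof -
  define k where "k = (\<lambda>n\<in>{0<..}. \<lfloor>s n - s 1\<rfloor>)"
  have ext: "s \<in> extensional {0<..}" and b: "\<And>n. n > 0 \<Longrightarrow> 0 \<le> s n \<and> s n < real n"
    and c: "\<And>n m. 0 < n \<Longrightarrow> 0 < m \<Longrightarrow> n dvd m \<Longrightarrow> s m rmod real n = s n"
    using s by (auto simp: topspace_solenoid PiE_def Pi_def)
  have kn: "s n = s 1 + of_int (k n)" "0 \<le> k n" "k n < int n" if n: "n > 0" for n
  proof -
    have "s n rmod real 1 = s 1" using c[of 1 n] n by simp
    then have e: "s n - s 1 = of_int \<lfloor>s n\<rfloor>" by (simp add: rmod_def)
    have k: "k n = \<lfloor>s n\<rfloor>" using n by (simp add: k_def e del: One_nat_def)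
    show "s n = s 1 + of_int (k n)" using e unfolding k by (metis add.commute diff_add_cancel)
    show "0 \<le> k n" using b[OF n] unfolding k by (metis zero_le_floor)
    have "s n < of_int (int n)" using b[OF n] by (metis of_int_of_nat_eq)
    then show "k n < int n" unfolding k by (metis floor_less_iff)
  qed
  have "k m mod int n = k n" if nm: "0 < n" "0 < m" "n dvd m" for n m
  proof -
    have "s m rmod real n = s n rmod real n" using c[OF nm] by (metis rmod_rmod)
    then obtain j :: int where "s m = s n + of_int j * real n"
      using rmod_eq_iff nm by blast
    then have "real_of_int (k m) = of_int (k n + j * int n)"
      using kn(1)[of n] kn(1)[of m] nm by simp
    then have "k m = k n + j * int n" by linarith
    then show ?thesis using kn(2,3)[of n] nm by simp
  qed
  then have "k \<in> topspace zhat"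
    using kn(2,3) by (auto simp: topspace_zhat PiE_def extensional_def k_def)
  moreover have "solenoid_proj (s 1, k) = s"
  proof (rule extensionalityI[of _ "{0<..}"])
    fix n :: nat assume "n \<in> {0<..}"
    then have n: "n > 0" by simp
    have "(s 1 + of_int (k n)) rmod real n = s n"
      using kn(1)[OF n] b[OF n] by (metis abs_of_nat atLeastLessThan_iff rmod_idem)
    then show "solenoid_proj (s 1, k) n = s n"
      using n by (simp add: solenoid_proj_def)
  qed (use ext in \<open>auto simp: solenoid_proj_def\<close>)
  ultimately show ?thesis by blast
qed

end

(* Equivariance of the lift reads \<delta>_k (x + t) = \<delta>_{k+t} (x) for integers t, so the values of \<delta>_k are those of the
   continuous function (y, l) \<mapsto> \<delta>_l (y) on the compact space [0,1] \<times> zhat. That function is uniformly continuous,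
   so up to \<epsilon> it depends on l only through l mod N for a suitable N. Since k + t + jN and k + t agree mod N,
   every multiple of N is an \<epsilon>-almost period of \<delta>_k. Correcting \<delta>_k on [0, N] by an affine function of size
   at most \<epsilon> makes its end values agree, and the N-periodic extension is uniformly 2\<epsilon>-close to \<delta>_k. *)
theory Submission
  imports Defs
begin

section \<open>Periodic functions from their values on one period\<close>

lemma continuous_on_periodic_extension:
  fixes h :: "real \<Rightarrow> 'a::topological_space"
  assumes N: "N > 0" and h: "continuous_on {0..N} h" and ends: "h 0 = h N"
  shows "continuous_on UNIV (\<lambda>x. h (x rmod N))"
proof -
  \<comment> \<open>The residue jumps from N back to 0 at the right endpoint; there
    \<open>ends\<close> gives the translate of \<open>h\<close> the same value.\<close>
  have piece: "continuous_on {of_int j * N..of_int (j + 1) * N} (\<lambda>x. h (x rmod N))" for j :: int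
  proof -
    have "h (x rmod N) = h (x - of_int j * N)" if x: "x \<in> {of_int j * N..of_int (j + 1) * N}" for x
    proof (cases "x = of_int (j + 1) * N")
      case True
      then have "x rmod N = 0"
        using N by (intro rmod_unique[where n = "j + 1"]) auto
      with True ends show ?thesis by (simp add: algebra_simps)
    next
      case False
      then have "x rmod N = x - of_int j * N"
        using x N by (intro rmod_unique[where n = j]) (auto simp: algebra_simps)
      then show ?thesis by simp
    qed
    moreover have "continuous_on {of_int j * N..of_int (j + 1) * N} (\<lambda>x. h (x - of_int j * N))"
      by (intro continuous_on_compose2[OF h] continuous_intros) (auto simp: algebra_simps)
    ultimately show ?thesis
      by (auto intro: continuous_on_eq)
  qed
  have "isCont (\<lambda>x. h (x rmod N)) x" for x
  proof -
    \<comment> \<open>The multiple of N nearest to x is where the two closed pieces meet, so x is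
      interior to their union even when x is itself a multiple of N.\<close>
    define j where "j = round (x / N)"
    define I where "I = {of_int (j - 1) * N..of_int (j - 1 + 1) * N} \<union> {of_int j * N..of_int (j + 1) * N}"
    have "continuous_on I (\<lambda>x. h (x rmod N))"
      unfolding I_def by (intro continuous_on_closed_Un piece) auto
    moreover have "x \<in> interior I"
    proof -
      have "\<bar>of_int j - x / N\<bar> < 1"
        using of_int_round_abs_le[of "x / N"] unfolding j_def by linarith
      then have "of_int (j - 1) < x / N" "x / N < of_int (j + 1)"
        by (auto simp: abs_less_iff)
      then have "x \<in> {of_int (j - 1) * N<..<of_int (j + 1) * N}"
        using N by (simp add: field_simps)
      moreover have "{of_int (j - 1) * N<..<of_int (j + 1) * N} \<subseteq> I"
        by (auto simp: I_def)
      ultimately show ?thesis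
        by (meson interiorI open_greaterThanLessThan)
    qed
    ultimately show ?thesis
      by (rule continuous_on_interior)
  qed
  then show ?thesis
    by (simp add: continuous_on_eq_continuous_at)
qed

lemma periodic_approximation:
  fixes \<phi> :: "real \<Rightarrow> real"
  assumes N: "N > 0" and cont: "continuous_on UNIV \<phi>"
    and almost: "\<And>x (j::int). \<bar>\<phi> (x + of_int j * N) - \<phi> x\<bar> \<le> e"
  shows "\<exists>\<psi>. periodic_function \<psi> \<and> (\<forall>x. \<bar>\<psi> x - \<phi> x\<bar> \<le> 2 * e)"
proof -
  define h where "h y = \<phi> y + y / N * (\<phi> 0 - \<phi> N)" for y
  define \<psi> where "\<psi> x = h (x rmod N)" for x
  have "continuous_on {0..N} h"
    unfolding h_def using N
    by (intro continuous_intros continuous_on_subset[OF cont]) auto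
  then have "continuous_on UNIV \<psi>"
    unfolding \<psi>_def using N by (intro continuous_on_periodic_extension) (auto simp: h_def)
  moreover have "\<psi> (x + N) = \<psi> x" for x
  proof -
    have "(x + N) rmod N = x rmod N"
      using N by (simp add: rmod_def add_divide_distrib algebra_simps)
    then show ?thesis by (simp add: \<psi>_def)
  qed
  ultimately have "periodic_function \<psi>"
    unfolding periodic_function_def using N by (metis less_irrefl)
  moreover have "\<bar>\<psi> x - \<phi> x\<bar> \<le> 2 * e" for x
  proof -
    \<comment> \<open>One e pays for moving x to its residue \<open>y\<close> by a multiple of N,
      the other for the affine correction at \<open>y\<close>, since 0 \<le> y / N < 1.\<close>
    define y where "y = x rmod N"
    have y: "0 \<le> y" "y < N"
      using N by (auto simp: y_def rmod_nonneg rmod_less)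
    have "x = y + of_int \<lfloor>x / N\<rfloor> * N"
      using N by (simp add: y_def rmod_def algebra_simps)
    then have "\<bar>\<phi> x - \<phi> y\<bar> \<le> e"
      using almost[of y "\<lfloor>x / N\<rfloor>"] by simp
    moreover define c where c_def: "c = y / N * (\<phi> 0 - \<phi> N)"
    have "\<bar>c\<bar> \<le> 1 * e"
      unfolding c_def abs_mult using y almost[of 0 1] by (intro mult_mono) auto
    moreover have "\<psi> x = \<phi> y + c"
      by (simp add: \<psi>_def h_def c_def flip: y_def)
    ultimately show ?thesis by linarith
  qed
  ultimately show ?thesis by blast
qed

section \<open>Compactness and residue classes of the profinite integers\<close>

lemma zhat_eq_subtopology_topspace:
  "zhat = subtopology (product_topology (\<lambda>n. discrete_topology {0..<int n}) {0<..}) (topspace zhat)"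
  unfolding zhat_def topspace_subtopology by (rule subtopology_restrict[symmetric])

text \<open>Tychonoff makes the product of the finite discrete spaces compact, and each coherence
  condition is closed in it, being the equalizer of two continuous maps into a discrete, hence
  Hausdorff, space.\<close>

lemma compact_space_zhat: "compact_space zhat"
proof -
  let ?P = "product_topology (\<lambda>n. discrete_topology {0..<int n}) {0<..}"
  let ?E = "\<lambda>n m. {k \<in> topspace ?P. k m mod int n = k n}"
  have proj: "continuous_map ?P (discrete_topology {0..<int n}) (\<lambda>k. k n)" if "0 < n" for n
    using that by (intro continuous_map_product_projection) auto
  have closed: "closedin ?P (?E n m)" if "0 < n" "0 < m" for n m
  proof -
    have "continuous_map ?P (discrete_topology {0..<int n}) ((\<lambda>a. a mod int n) \<circ> (\<lambda>k. k m))"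
      using that by (intro continuous_map_compose[OF proj]) auto
    then show ?thesis
      using closedin_continuous_maps_eq[OF _ _ proj] that by (auto simp: o_def)
  qed
  have "topspace zhat = topspace ?P \<inter> (\<Inter>(n, m)\<in>{(n, m). 0 < n \<and> 0 < m \<and> n dvd m}. ?E n m)"
    by (auto simp: topspace_zhat)
  also have "closedin ?P \<dots>"
  proof (rule closedin_Int[OF closedin_topspace])
    show "closedin ?P (\<Inter>(n, m)\<in>{(n, m). 0 < n \<and> 0 < m \<and> n dvd m}. ?E n m)"
      \<comment> \<open>\<open>closedin_INT\<close> needs a nonempty family; the value 1 supplies an
        index.\<close>
      by (rule closedin_INT) (use closed in \<open>auto intro: exI[of _ 1]\<close>)
  qed
  finally have "closedin ?P (topspace zhat)" .
  moreover have "compact_space ?P"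
    by (auto simp: compact_space_product_topology compact_space_discrete_topology)
  ultimately have "compactin ?P (topspace zhat)"
    by (simp add: closedin_compact_space)
  then have "compact_space (subtopology ?P (topspace zhat))"
    by (simp add: compact_space_subtopology)
  then show ?thesis
    by (simp flip: zhat_eq_subtopology_topspace)
qed

text \<open>Lets finitely many congruence conditions be merged into a single one at a common
  multiple of the moduli.\<close>

lemma zhat_residue_cong:
  assumes "k \<in> topspace zhat" "l \<in> topspace zhat" "k N = l N" "n dvd N" "0 < N"
  shows "k n = l n"
proof -
  have "0 < n"
    using assms(4,5) by (rule dvd_pos_nat[rotated])
  then have "k N mod int n = k n" "l N mod int n = l n"
    using assms(1,2,4,5) by (auto simp: topspace_zhat)
  with assms(3) show ?thesis by simp
qed

text \<open>A basic open set of the product constrains only finitely many coordinates, and by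
  coherence one coordinate at a common multiple of their indices fixes them all.\<close>

lemma openin_zhat_contains_residue_class:
  assumes U: "openin zhat U" and k: "k \<in> U"
  obtains n where "0 < n" "{l \<in> topspace zhat. l n = k n} \<subseteq> U"
proof -
  obtain T where T: "openin (product_topology (\<lambda>n. discrete_topology {0..<int n}) {0<..}) T"
    and U_eq: "U = T \<inter> topspace zhat"
    using U by (metis zhat_eq_subtopology_topspace openin_subtopology)
  have kT: "k \<in> T" and kz: "k \<in> topspace zhat"
    using k U_eq by auto
  obtain B where B: "finite {n \<in> {0<..}. B n \<noteq> topspace (discrete_topology {0..<int n})}"
    and kB: "k \<in> Pi\<^sub>E {0<..} B" and BT: "Pi\<^sub>E {0<..} B \<subseteq> T"
    using T kT unfolding openin_product_topology_alt by meson
  define S where "S = {n \<in> {0<..}. B n \<noteq> topspace (discrete_topology {0..<int n})}"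
  have S: "finite S" "\<And>n. n \<in> S \<Longrightarrow> 0 < n" "\<And>n. 0 < n \<Longrightarrow> n \<notin> S \<Longrightarrow> B n = {0..<int n}"
    using B by (auto simp: S_def)
  \<comment> \<open>If no coordinate is constrained, the empty product gives N = 1.\<close>
  define N where "N = \<Prod>S"
  have N: "0 < N" "\<And>n. n \<in> S \<Longrightarrow> n dvd N"
    using S by (auto simp: N_def prod_pos intro: dvd_prodI[where f = "\<lambda>n. n"])
  have "l \<in> U" if l: "l \<in> topspace zhat" "l N = k N" for l
  proof -
    have "l n \<in> B n" if n: "0 < n" for n
    proof (cases "n \<in> S")
      case True
      then have "l n = k n"
        using zhat_residue_cong[OF l(1) kz l(2)] N by blast
      then show ?thesis using kB n by auto
    next
      case False
      then show ?thesis using S(3)[OF n] l(1) n by (auto simp: topspace_zhat PiE_def Pi_def)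
    qed
    then have "l \<in> Pi\<^sub>E {0<..} B"
      using l(1) by (auto simp: topspace_zhat PiE_def)
    with BT U_eq l(1) show ?thesis by blast
  qed
  then show thesis
    using N(1) that by blast
qed

text \<open>Uniform continuity in the profinite variable, with congruence mod N in place of a
  metric. A finite subcover of \<open>K \<times> topspace zhat\<close> leaves finitely many moduli,
  whose product serves as N.\<close>

lemma zhat_uniform_continuity:
  fixes g :: "real \<times> (nat \<Rightarrow> int) \<Rightarrow> real"
  assumes g: "continuous_map (prod_topology euclideanreal zhat) euclideanreal g"
    and K: "compact K" and e: "e > 0"
  obtains N where "0 < N"
    "\<And>y k l. y \<in> K \<Longrightarrow> k \<in> topspace zhat \<Longrightarrow> l \<in> topspace zhat \<Longrightarrow> k N = l N \<Longrightarrow> \<bar>g (y, k) - g (y, l)\<bar> < e"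
proof -
  let ?X = "prod_topology euclideanreal zhat"
  let ?C = "K \<times> topspace zhat"
  define good where "good n B \<longleftrightarrow> 0 < n \<and>
      (\<forall>z k l. (z, k) \<in> B \<longrightarrow> l \<in> topspace zhat \<longrightarrow> k n = l n \<longrightarrow> \<bar>g (z, k) - g (z, l)\<bar> < e)" for n B
  have cylinder: "openin zhat {l \<in> topspace zhat. l m = a}" if "0 < m" for m a
  proof -
    have "continuous_map zhat (discrete_topology {0..<int m}) (\<lambda>k. k m)"
      unfolding zhat_def using that
      by (intro continuous_map_from_subtopology continuous_map_product_projection) auto
    \<comment> \<open>Since \<open>a\<close> may lie outside \<open>{0..<int m}\<close>,
      \<open>{a}\<close> is intersected with the carrier to obtain an open set.\<close>
    then have "openin zhat {l \<in> topspace zhat. l m \<in> {a} \<inter> {0..<int m}}"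
      by (rule openin_continuous_map_preimage) auto
    moreover have "{l \<in> topspace zhat. l m \<in> {a} \<inter> {0..<int m}} = {l \<in> topspace zhat. l m = a}"
      using that by (auto simp: topspace_zhat PiE_def Pi_def)
    ultimately show ?thesis by simp
  qed
  have local: "\<exists>B n. openin ?X B \<and> p \<in> B \<and> good n B" if p: "p \<in> ?C" for p
  proof -
    define Q where "Q = {q \<in> topspace ?X. g q \<in> ball (g p) (e / 2)}"
    have "openin ?X Q"
      unfolding Q_def using g by (intro openin_continuous_map_preimage) auto
    moreover have "(fst p, snd p) \<in> Q"
      unfolding Q_def using p e by auto
    ultimately have "\<exists>V W. openin euclideanreal V \<and> openin zhat W \<and> fst p \<in> V \<and> snd p \<in> W \<and> V \<times> W \<subseteq> Q"
      unfolding openin_prod_topology_alt by blast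
    then obtain V W where V: "openin euclideanreal V" "fst p \<in> V" and W: "openin zhat W" "snd p \<in> W"
      and VW: "V \<times> W \<subseteq> Q"
      by blast
    obtain n where n: "0 < n" "{l \<in> topspace zhat. l n = snd p n} \<subseteq> W"
      using openin_zhat_contains_residue_class[OF W] by blast
    \<comment> \<open>The second factor is a full residue class, so replacing k by a congruent l
      stays in \<open>B\<close>; both values are then within e / 2 of \<open>g p\<close>, and no
      Lebesgue number is needed.\<close>
    define B where "B = V \<times> {l \<in> topspace zhat. l n = snd p n}"
    have close: "\<bar>g q - g p\<bar> < e / 2" if "q \<in> B" for q
    proof -
      have "q \<in> Q" using that n VW by (auto simp: B_def)
      then show ?thesis by (simp add: Q_def dist_real_def abs_minus_commute)
    qed
    have "\<bar>g (z, k) - g (z, l)\<bar> < e" if "(z, k) \<in> B" "l \<in> topspace zhat" "k n = l n" for z k l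
    proof -
      have "(z, l) \<in> B" using that by (auto simp: B_def)
      then show ?thesis using close[of "(z, k)"] close[of "(z, l)"] that(1) by linarith
    qed
    then have "good n B"
      using n(1) by (simp add: good_def)
    moreover have "openin ?X B"
      unfolding B_def using V(1) cylinder[OF n(1)] by (simp add: openin_prod_Times_iff)
    moreover have "p \<in> B"
      using V(2) p by (auto simp: B_def)
    ultimately show ?thesis by blast
  qed
  have "compactin ?X ?C"
    using K compact_space_zhat by (simp add: compactin_Times compact_space_def)
  moreover have "?C \<subseteq> \<Union>{B. openin ?X B \<and> (\<exists>n. good n B)}"
    using local by blast
  ultimately obtain \<F> where \<F>: "finite \<F>" "\<F> \<subseteq> {B. openin ?X B \<and> (\<exists>n. good n B)}"
    and cover: "?C \<subseteq> \<Union>\<F>"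
    using compactinD[of ?X ?C "{B. openin ?X B \<and> (\<exists>n. good n B)}"] by blast
  have "\<forall>B\<in>\<F>. \<exists>n. good n B"
    using \<F>(2) by blast
  then obtain n where n: "\<And>B. B \<in> \<F> \<Longrightarrow> good (n B) B"
    using bchoice[of \<F> "\<lambda>B n. good n B"] by blast
  define N where "N = prod n \<F>"
  have N: "0 < N"
    unfolding N_def using n by (intro prod_pos) (auto simp: good_def)
  have "\<bar>g (y, k) - g (y, l)\<bar> < e"
    if y: "y \<in> K" and k: "k \<in> topspace zhat" and l: "l \<in> topspace zhat" and kl: "k N = l N" for y k l
  proof -
    obtain B where B: "B \<in> \<F>" "(y, k) \<in> B"
      using cover y k by blast
    have "n B dvd N"
      unfolding N_def using \<F>(1) B(1) by (rule dvd_prodI)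
    then have "k (n B) = l (n B)"
      using zhat_residue_cong[OF k l kl] N by blast
    then show ?thesis
      using n[OF B(1)] B(2) l by (simp add: good_def)
  qed
  with N show thesis by (rule that)
qed

section \<open>Limit periodicity of the displacement functions\<close>

lemma limit_periodicI:
  assumes "\<And>e. e > 0 \<Longrightarrow> \<exists>\<psi>. periodic_function \<psi> \<and> (\<forall>x. \<bar>\<psi> x - \<phi> x\<bar> \<le> e)"
  shows "limit_periodic \<phi>"
proof -
  have "\<exists>\<psi>. periodic_function \<psi> \<and> (\<forall>x. \<bar>\<psi> x - \<phi> x\<bar> \<le> inverse (real (Suc i)))" for i
    by (rule assms) simp
  then obtain \<psi> where \<psi>: "\<And>i. periodic_function (\<psi> i)"
    "\<And>i x. \<bar>\<psi> i x - \<phi> x\<bar> \<le> inverse (real (Suc i))"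
    by metis
  have "uniform_limit UNIV \<psi> \<phi> sequentially"
  proof (rule uniform_limitI)
    fix e :: real assume "e > 0"
    then have "\<forall>\<^sub>F i in sequentially. inverse (real (Suc i)) < e"
      using LIMSEQ_inverse_real_of_nat by (rule order_tendstoD(2)[rotated])
    then show "\<forall>\<^sub>F i in sequentially. \<forall>x\<in>UNIV. dist (\<psi> i x) (\<phi> x) < e"
      by eventually_elim (use \<psi>(2) in \<open>auto simp: dist_real_def intro: le_less_trans\<close>)
  qed
  with \<psi>(1) show ?thesis
    unfolding limit_periodic_def by blast
qed

theorem theorem2p4:
  fixes f :: "(nat \<Rightarrow> real) \<Rightarrow> nat \<Rightarrow> real"
    and F :: "real \<times> (nat \<Rightarrow> int) \<Rightarrow> real \<times> (nat \<Rightarrow> int)"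
    and \<delta> :: "(nat \<Rightarrow> int) \<Rightarrow> real \<Rightarrow> real"
  assumes "f \<in> homeo_plus"
    and "is_lift f F"
    and "\<And>x k. k \<in> topspace zhat \<Longrightarrow> F (x, k) = (x + \<delta> k x, k)"
  shows "\<forall>k\<in>topspace zhat. periodic_function (\<delta> k) \<or> purely_limit_periodic (\<delta> k)"
proof
  fix k assume k: "k \<in> topspace zhat"
  let ?X = "prod_topology euclideanreal zhat"
  \<comment> \<open>This is k + t, written as k - (-t).\<close>
  let ?shift = "\<lambda>t::int. zhat_diff k (zhat_of_int (- t))"
  have leaf: "leaf_map F l x = x + \<delta> l x" if "l \<in> topspace zhat" for l x
    using assms(3)[OF that] by (simp add: leaf_map_def)
  have in_zhat: "?shift t \<in> topspace zhat" for t
    using k by (intro zhat_diff_in zhat_of_int_in)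
  have shift: "\<delta> k (x + of_int t) = \<delta> (?shift t) x" for x t
  proof -
    \<comment> \<open>Equivariance is used at x + t with the integer -t, so the argument on the left
      returns to x and the two -t cancel in terms of displacements.\<close>
    have "leaf_map F (?shift t) (x + of_int t + of_int (- t)) = leaf_map F k (x + of_int t) + of_int (- t)"
      using assms(2) k unfolding is_lift_def by blast
    then show ?thesis
      using leaf[OF k] leaf[OF in_zhat] by simp
  qed
  have cont: "continuous_on UNIV (\<delta> k)"
    using assms(2) k leaf[OF k] by (auto simp: is_lift_def)
  have "continuous_map ?X ?X F"
    using assms(2) by (simp add: is_lift_def)
  then have "continuous_map ?X euclideanreal (fst \<circ> F)"
    by (rule continuous_map_compose) (rule continuous_map_fst)
  \<comment> \<open>Joint continuity of the displacement in both variables comes from that of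
    \<open>F\<close>; continuity along each leaf would not give uniformity over
    \<open>zhat\<close>.\<close>
  then have "continuous_map ?X euclideanreal (\<lambda>p. (fst \<circ> F) p - fst p)"
    by (rule continuous_map_diff) (rule continuous_map_fst)
  then have "continuous_map ?X euclideanreal (\<lambda>p. \<delta> (snd p) (fst p))"
    by (rule continuous_map_eq) (use assms(3) in auto)
  note unif = zhat_uniform_continuity[OF this compact_Icc[of 0 1], unfolded fst_conv snd_conv]
  have "limit_periodic (\<delta> k)"
  proof (rule limit_periodicI)
    fix e :: real assume "e > 0"
    \<comment> \<open>Halved because \<open>periodic_approximation\<close> doubles the
      error.\<close>
    then have "e / 2 > 0" by simp
    from unif[OF this] obtain N where N: "0 < N" and close:
      "\<And>y l m. y \<in> {0..1} \<Longrightarrow> l \<in> topspace zhat \<Longrightarrow> m \<in> topspace zhat \<Longrightarrow> l N = m N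
        \<Longrightarrow> \<bar>\<delta> l y - \<delta> m y\<bar> < e / 2"
      by auto
    have "\<bar>\<delta> k (x + of_int j * real N) - \<delta> k x\<bar> \<le> e / 2" for x and j :: int
    proof -
      \<comment> \<open>The integer part of x moves into the profinite variable and the fractional
        part stays in [0,1]. Adding jN to x keeps the fractional part and changes the profinite
        point only by jN, which vanishes mod N.\<close>
      define t where "t = \<lfloor>x\<rfloor>"
      have res: "?shift s N = (k N + s) mod int N" for s
        using N by (simp add: zhat_diff_def zhat_of_int_def mod_diff_right_eq)
      have "?shift (t + j * int N) N = ?shift t N"
        unfolding res by (metis add.assoc mod_mult_self1)
      then have "\<bar>\<delta> (?shift (t + j * int N)) (frac x) - \<delta> (?shift t) (frac x)\<bar> < e / 2"
        by (intro close in_zhat) (auto simp: less_imp_le[OF frac_lt_1])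
      moreover have "x + of_int j * real N = frac x + of_int (t + j * int N)" "x = frac x + of_int t"
        by (simp_all add: t_def frac_def)
      ultimately show ?thesis
        by (metis shift less_imp_le)
    qed
    from periodic_approximation[OF _ cont this]
    show "\<exists>\<psi>. periodic_function \<psi> \<and> (\<forall>x. \<bar>\<psi> x - \<delta> k x\<bar> \<le> e)"
      using N by simp
  qed
  then show "periodic_function (\<delta> k) \<or> purely_limit_periodic (\<delta> k)"
    by (auto simp: purely_limit_periodic_def)
qed

end
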